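(* Let $P$ be a primary Puiseux monoid. Then the following two conditions hold. (1) If $0$ is not a limit point of $P$, then $\rho_k(P) < \infty$ for every $k \in \mathbb{N}$. (2) If $P$ is bounded and has no stable atoms, then $\rho_k(P) < \infty$ for every $k \in \mathbb{N}$.
   Context: $\mathbb{N}$ denotes the set of positive integers and $\mathbb{N}_0 = \mathbb{N}\cup\{0\}$. A Puiseux monoid is an additive submonoid of $(\mathbb{Q},+)$ consisting of nonnegative rationals. For a rational $q>0$, $\mathsf{n}(q)$ and $\mathsf{d}(q)$ denote the unique relatively prime positive integers with $q = \mathsf{n}(q)/\mathsf{d}(q)$ (numerator and denominator). A Puiseux monoid $P$ is primary if it can be generated (as a monoid) by a subset of positive rationals whose denominators are pairwise distinct prime numbers. It is bounded if it can be generated by a bounded set of rational numbers. That $0$ is a limit point of $P$ means that $P$ contains nonzero elements arbitrarily close to $0$. An element $a \in P\setminus\{0\}$ is an atom if $a = x+y$ with $x,y\in P$ implies $x=0$ or $y=0$; $\mathcal{A}(P)$ denotes the set of atoms of $P$. An atom $a_0 \in \mathcal{A}(P)$ is stable if the set $\{a \in \mathcal{A}(P) : \mathsf{n}(a) = \mathsf{n}(a_0)\}$ is infinite. A factorization of $x \in P$ is a formal sum (up to permutation) $a_1+\dots+a_\ell$ of atoms of $P$ (repetitions allowed) whose value in $P$ is $x$; its length is $\ell$. $\mathsf{L}(x)$ is the set of all lengths of factorizations of $x$. For $n\in\mathbb{N}_0$, $\mathcal{U}_n(P)$ is the union of the sets $\mathsf{L}(x)$ over all $x \in P$ with $n \in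 \mathsf{L}(x)$, and $\rho_n(P) = \sup \mathcal{U}_n(P)$ (supremum taken in $\mathbb{N}_0\cup\{\infty\}$) is the $n$-th local elasticity of $P$. *)

theory Defs
  imports "HOL-Analysis.Analysis"
begin

definition add_submonoid :: "rat set \<Rightarrow> bool" where
  "add_submonoid M \<longleftrightarrow> 0 \<in> M \<and> (\<forall>x\<in>M. \<forall>y\<in>M. x + y \<in> M)"

definition puiseux_monoid :: "rat set \<Rightarrow> bool" where
  "puiseux_monoid P \<longleftrightarrow> add_submonoid P \<and> (\<forall>x\<in>P. 0 \<le> x)"

abbreviation monoid_span :: "rat set \<Rightarrow> rat set" where
  "monoid_span S \<equiv> add_submonoid hull S"

text \<open>\<^const>\<open>quotient_of\<close> returns the reduced fraction with positive denominator.\<close>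

definition rat_num :: "rat \<Rightarrow> int" where
  "rat_num q = fst (quotient_of q)"

definition rat_den :: "rat \<Rightarrow> int" where
  "rat_den q = snd (quotient_of q)"

definition primary_pm :: "rat set \<Rightarrow> bool" where
  "primary_pm P \<longleftrightarrow> puiseux_monoid P \<and>
     (\<exists>S. (\<forall>q\<in>S. 0 < q \<and> prime (rat_den q)) \<and> inj_on rat_den S \<and> P = monoid_span S)"

definition bounded_pm :: "rat set \<Rightarrow> bool" where
  "bounded_pm P \<longleftrightarrow> (\<exists>S. bdd_below S \<and> bdd_above S \<and> P = monoid_span S)"

definition atoms :: "rat set \<Rightarrow> rat set" where
  "atoms P = {a \<in> P - {0}. \<forall>x\<in>P. \<forall>y\<in>P. a = x + y \<longrightarrow> x = 0 \<or> y = 0}"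

definition stable_atom :: "rat set \<Rightarrow> rat \<Rightarrow> bool" where
  "stable_atom P a\<^sub>0 \<longleftrightarrow> a\<^sub>0 \<in> atoms P \<and> infinite {a \<in> atoms P. rat_num a = rat_num a\<^sub>0}"

definition factorizations :: "rat set \<Rightarrow> rat \<Rightarrow> rat multiset set" where
  "factorizations P x = {F. set_mset F \<subseteq> atoms P \<and> sum_mset F = x}"

definition length_set :: "rat set \<Rightarrow> rat \<Rightarrow> nat set" where
  "length_set P x = size ` factorizations P x"

definition union_lengths :: "rat set \<Rightarrow> nat \<Rightarrow> nat set" where
  "union_lengths P n = (\<Union>x\<in>{x \<in> P. n \<in> length_set P x}. length_set P x)"

text \<open>If no element has a factorization of length \<open>n\<close>, then the supremum below is
  \<open>Sup {} = 0\<close>; this happens for \<open>n > 0\<close> exactly when there are no atoms.\<close>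

definition local_elasticity :: "rat set \<Rightarrow> nat \<Rightarrow> enat" where
  "local_elasticity P n = Sup (enat ` union_lengths P n)"

end

theory Submission
  imports Defs
begin

text \<open>
  Every atom of a primary monoid is one of the generators, so the atoms are positive and their
  denominators are pairwise distinct primes. Hence, if \<open>a\<close> is an atom with denominator \<open>p\<close>, every
  other atom is \<open>p\<close>-integral, and two factorizations of the same element use \<open>a\<close> with
  multiplicities that are congruent modulo \<open>p\<close> (\<open>count_cong_mod_den\<close>).

  Let \<open>F\<close> be a factorization of length at most \<open>k\<close> and \<open>G\<close> another factorization of the same
  element. If the denominator of \<open>a\<close> exceeds \<open>k\<close>, the congruence forces \<open>G\<close> to contain \<open>a\<close> at least
  as often as \<open>F\<close> does. Thus all such atoms of \<open>F\<close> cancel; they account for at most \<open>k\<close> of the length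
  of \<open>G\<close>. What remains of \<open>F\<close> uses only the finitely many atoms with denominator at most \<open>k\<close>, so
  its value is at most some \<open>B\<close> that depends only on \<open>k\<close> and the monoid. What remains of \<open>G\<close> has
  the same value, and an atom in it with denominator \<open>p > k\<close> now occurs at least \<open>p\<close> times, since
  its multiplicity is congruent to \<open>0\<close>; these copies alone contribute at least the numerator of the
  atom, which is therefore at most \<open>B\<close>. If all atoms with denominator at most \<open>k\<close> or numerator at most \<open>B\<close> are
  bounded below by some \<open>\<epsilon> > 0\<close>, the rest of \<open>G\<close> has at most \<open>B / \<epsilon>\<close> entries
  (\<open>local_elasticity_finite\<close>).

  Such an \<open>\<epsilon>\<close> exists in both parts of the theorem: if \<open>0\<close> is not a limit point, then all nonzero
  elements are bounded away from \<open>0\<close>; if there is no stable atom, then only finitely many atoms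
  have a numerator at most \<open>B\<close>, and a finite set of positive numbers has a positive lower bound.
\<close>

section \<open>Numerators and denominators\<close>

lemma rat_den_pos: "0 < rat_den q"
  unfolding rat_den_def by (rule quotient_of_denom_pos')

lemma coprime_num_den: "coprime (rat_num q) (rat_den q)"
  unfolding rat_num_def rat_den_def by (rule quotient_of_coprime) simp

lemma den_times_self: "of_int (rat_den q) * q = of_int (rat_num q)"
proof -
  have "q = of_int (rat_num q) / of_int (rat_den q)"
    unfolding rat_num_def rat_den_def by (rule quotient_of_div) simp
  then show ?thesis
    using rat_den_pos[of q] by (simp add: field_simps)
qed

lemma rat_num_pos:
  assumes "0 < q"
  shows "0 < rat_num q"
proof -
  have "(0::rat) < of_int (rat_den q) * q"
    using assms rat_den_pos[of q] by simp
  then show ?thesis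
    by (simp add: den_times_self)
qed

section \<open>Sums of multisets of rationals\<close>

lemma sum_mset_split_count:
  fixes F :: "rat multiset"
  shows "sum_mset F = of_nat (count F a) * a + sum_mset (filter_mset (\<lambda>x. x \<noteq> a) F)"
  by (induction F) (auto simp: algebra_simps)

lemma size_times_le_sum_mset:
  fixes F :: "rat multiset"
  assumes "\<And>x. x \<in># F \<Longrightarrow> e \<le> x"
  shows "of_nat (size F) * e \<le> sum_mset F"
  using assms by (induction F) (auto simp: algebra_simps intro: add_mono)

lemma sum_mset_le_size_times:
  fixes F :: "rat multiset"
  assumes "\<And>x. x \<in># F \<Longrightarrow> x \<le> b"
  shows "sum_mset F \<le> of_nat (size F) * b"
  using assms by (induction F) (auto simp: algebra_simps intro: add_mono)

text \<open>A common denominator of the summands serves as \<open>D\<close>; it stays prime to \<open>p\<close> because \<open>p\<close> is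
  prime.\<close>

lemma sum_mset_common_den:
  fixes p :: int
  assumes "prime p" and "\<And>x. x \<in># F \<Longrightarrow> \<not> p dvd rat_den x"
  shows "\<exists>D N. \<not> p dvd D \<and> of_int D * sum_mset F = of_int N"
  using assms(2)
proof (induction F)
  case empty
  have "\<not> p dvd 1"
    using assms(1) not_prime_unit by blast
  then show ?case
    by (intro exI[of _ 1] exI[of _ 0]) simp
next
  case (add x F)
  then obtain D N where D: "\<not> p dvd D" "of_int D * sum_mset F = of_int N"
    by auto
  have "\<not> p dvd D * rat_den x"
    using D(1) add.prems assms(1) by (simp add: prime_dvd_mult_iff)
  moreover have "of_int (D * rat_den x) * sum_mset (add_mset x F)
      = of_int D * (of_int (rat_den x) * x) + of_int (rat_den x) * (of_int D * sum_mset F)"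
    by (simp add: algebra_simps)
  then have "of_int (D * rat_den x) * sum_mset (add_mset x F)
      = of_int (D * rat_num x + rat_den x * N)"
    by (simp add: D(2) den_times_self)
  ultimately show ?case
    by blast
qed

section \<open>Comparing two factorizations\<close>

text \<open>Clear the denominators of all summands other than \<open>a\<close> by a factor prime to \<open>p = rat_den a\<close>:
  the difference of the two multiplicities times \<open>a\<close> becomes an integer, and the numerator of
  \<open>a\<close> is prime to \<open>p\<close>, so \<open>p\<close> divides that difference.\<close>

lemma count_cong_mod_den:
  assumes prime_den: "\<And>a. a \<in> A \<Longrightarrow> prime (rat_den a)" and inj: "inj_on rat_den A"
    and F: "set_mset F \<subseteq> A" and G: "set_mset G \<subseteq> A"
    and eq: "sum_mset F = sum_mset G" and a: "a \<in> A"
  shows "rat_den a dvd int (count F a) - int (count G a)"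
proof -
  let ?p = "rat_den a"
  define d where "d = int (count F a) - int (count G a)"
  have other: "\<not> ?p dvd rat_den x" if "x \<in> A" "x \<noteq> a" for x
    using that a prime_den inj primes_dvd_imp_eq by (metis inj_on_def)
  obtain D N where D: "\<not> ?p dvd D"
      "of_int D * sum_mset (filter_mset (\<lambda>x. x \<noteq> a) F) = of_int N"
    using sum_mset_common_den[of ?p "filter_mset (\<lambda>x. x \<noteq> a) F"] prime_den[OF a] other F by auto
  obtain E M where E: "\<not> ?p dvd E"
      "of_int E * sum_mset (filter_mset (\<lambda>x. x \<noteq> a) G) = of_int M"
    using sum_mset_common_den[of ?p "filter_mset (\<lambda>x. x \<noteq> a) G"] prime_den[OF a] other G by auto
  let ?RF = "sum_mset (filter_mset (\<lambda>x. x \<noteq> a) F)"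
  let ?RG = "sum_mset (filter_mset (\<lambda>x. x \<noteq> a) G)"
  have "of_nat (count F a) * a + ?RF = of_nat (count G a) * a + ?RG"
    using eq by (simp flip: sum_mset_split_count)
  then have "of_int d * a = ?RG - ?RF"
    by (simp add: d_def algebra_simps)
  then have "of_int (D * E) * (of_int ?p * (of_int d * a))
      = of_int (D * E) * (of_int ?p * (?RG - ?RF))"
    by (simp only:)
  then have "of_int (D * E) * (of_int d * (of_int ?p * a))
      = of_int ?p * (of_int D * (of_int E * ?RG) - of_int E * (of_int D * ?RF))"
    by (simp add: algebra_simps)
  then have "of_int (D * E * (d * rat_num a)) = (of_int (?p * (D * M - E * N)) :: rat)"
    by (simp add: D(2) E(2) den_times_self)
  then have "D * E * (d * rat_num a) = ?p * (D * M - E * N)"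
    by (simp only: of_int_eq_iff)
  then have "?p dvd D * E * (d * rat_num a)"
    by simp
  moreover have "\<not> ?p dvd rat_num a"
    using coprime_num_den[of a] prime_den[OF a]
    by (metis coprime_common_divisor dvd_refl not_prime_unit)
  ultimately show ?thesis
    using D(1) E(1) prime_den[OF a] unfolding d_def[symmetric] by (simp add: prime_dvd_mult_iff)
qed

lemma finite_bounded_den:
  fixes m :: int
  assumes "inj_on rat_den A"
  shows "finite {a \<in> A. rat_den a \<le> m}"
proof (rule finite_imageD)
  have "rat_den ` {a \<in> A. rat_den a \<le> m} \<subseteq> {0..m}"
    using rat_den_pos[THEN less_imp_le] by auto
  then show "finite (rat_den ` {a \<in> A. rat_den a \<le> m})"
    by (rule finite_subset) simp
  show "inj_on rat_den {a \<in> A. rat_den a \<le> m}"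
    using assms by (rule inj_on_subset) auto
qed

text \<open>The atoms of \<open>F\<close> with denominator above \<open>k\<close> cancel against \<open>G\<close>; the leftover \<open>F'\<close>
  determines the common value of the leftovers. The bound \<open>B\<close> is chosen by the caller, since it must
  not depend on \<open>F\<close> and \<open>G\<close>.\<close>

lemma factorization_length_bound:
  assumes prime_den: "\<And>a. a \<in> A \<Longrightarrow> prime (rat_den a)" and inj: "inj_on rat_den A"
    and pos: "\<And>a. a \<in> A \<Longrightarrow> 0 < a"
    and F: "set_mset F \<subseteq> A" and G: "set_mset G \<subseteq> A"
    and eq: "sum_mset F = sum_mset G" and size: "size F \<le> k"
    and B: "sum_mset (filter_mset (\<lambda>a. rat_den a \<le> int k) F) \<le> B"
    and e: "0 < e" "\<And>a. a \<in> A \<Longrightarrow> rat_den a \<le> int k \<or> of_int (rat_num a) \<le> B \<Longrightarrow> e \<le> a"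
  shows "of_nat (size G) \<le> of_nat k + B / e"
proof -
  define F' where "F' = filter_mset (\<lambda>a. rat_den a \<le> int k) F"
  define C where "C = filter_mset (\<lambda>a. \<not> rat_den a \<le> int k) F"
  have F_split: "F = F' + C"
    unfolding F'_def C_def by (rule multiset_partition)
  have "count C a \<le> count G a" for a
  proof (cases "a \<in># C")
    case True
    then have a: "a \<in> A" "rat_den a > int k"
      using F by (auto simp: C_def)
    have dvd: "rat_den a dvd int (count F a) - int (count G a)"
      by (rule count_cong_mod_den[OF prime_den inj F G eq a(1)])
    have le: "count F a \<le> k"
      by (rule order_trans[OF count_le_size size])
    have "count F a \<le> count G a"
    proof (rule ccontr)
      assume "\<not> count F a \<le> count G a"
      then have "rat_den a \<le> int (count F a) - int (count G a)"
        using zdvd_imp_le[OF dvd] by linarith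
      then show False
        using a(2) le by linarith
    qed
    then show ?thesis
      by (simp add: C_def)
  qed (simp add: not_in_iff)
  then have "C \<subseteq># G"
    by (rule mset_subset_eqI)
  then obtain G' where G_split: "G = C + G'"
    by (metis mset_subset_eq_exists_conv)
  have F': "set_mset F' \<subseteq> A" and G': "set_mset G' \<subseteq> A"
    using F G by (auto simp: F_split G_split)
  have eq': "sum_mset F' = sum_mset G'"
    using eq by (simp add: F_split G_split)
  have le_B: "sum_mset G' \<le> B"
    using B eq' by (simp add: F'_def)
  have "e \<le> a" if a: "a \<in># G'" for a
  proof (cases "rat_den a \<le> int k")
    case True
    then show ?thesis
      using e(2) a G' by auto
  next
    case False
    have aA: "a \<in> A"
      using a G' by auto
    have "count F' a = 0"
      using False by (simp add: F'_def)
    then have "rat_den a dvd int (count G' a)"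
      using count_cong_mod_den[OF prime_den inj F' G' eq' aA] by simp
    then have "rat_den a \<le> int (count G' a)"
      using a by (intro zdvd_imp_le) auto
    then have "of_int (rat_den a) * a \<le> of_int (int (count G' a)) * a"
      using pos[OF aA] by (intro mult_right_mono) (simp_all only: of_int_le_iff less_imp_le)
    moreover have "0 \<le> x" if "x \<in># filter_mset (\<lambda>x. x \<noteq> a) G'" for x
      using that G' pos[of x] by auto
    then have "0 \<le> sum_mset (filter_mset (\<lambda>x. x \<noteq> a) G')"
      using size_times_le_sum_mset[of "filter_mset (\<lambda>x. x \<noteq> a) G'" 0] by simp
    ultimately have "of_int (rat_num a) \<le> sum_mset G'"
      using sum_mset_split_count[of G' a] by (simp add: den_times_self)
    then show ?thesis
      using e(2)[OF aA] le_B by linarith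
  qed
  then have "of_nat (size G') * e \<le> sum_mset G'"
    by (rule size_times_le_sum_mset)
  then have "of_nat (size G') * e \<le> B"
    using le_B by linarith
  then have "of_nat (size G') \<le> B / e"
    using e(1) by (simp add: field_simps)
  moreover have "size C \<le> k"
    using size by (simp add: F_split)
  then have "(of_nat (size C) :: rat) \<le> of_nat k"
    by (simp only: of_nat_le_iff)
  ultimately show ?thesis
    by (simp add: G_split)
qed

text \<open>The hypothesis quantifies over all \<open>B\<close> because the bound that is needed comes out of the
  proof: \<open>k\<close> times an upper bound for the atoms of denominator at most \<open>k\<close>.\<close>

lemma local_elasticity_finite:
  assumes prime_den: "\<And>a. a \<in> atoms P \<Longrightarrow> prime (rat_den a)"
    and inj: "inj_on rat_den (atoms P)"
    and pos: "\<And>a. a \<in> atoms P \<Longrightarrow> 0 < a"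
    and low: "\<And>B :: rat. \<exists>e>0. \<forall>a\<in>atoms P.
      rat_den a \<le> int k \<or> of_int (rat_num a) \<le> B \<longrightarrow> e \<le> a"
  shows "local_elasticity P k < \<infinity>"
proof -
  have "bdd_above {a \<in> atoms P. rat_den a \<le> int k}"
    by (intro bdd_above_finite finite_bounded_den inj)
  then obtain b0 where "\<And>a. a \<in> {a \<in> atoms P. rat_den a \<le> int k} \<Longrightarrow> a \<le> b0"
    unfolding bdd_above_def by blast
  then obtain b where b: "0 \<le> b" "\<And>a. a \<in> atoms P \<Longrightarrow> rat_den a \<le> int k \<Longrightarrow> a \<le> b"
    by (intro that[of "max 0 b0"]) (auto simp: le_max_iff_disj)
  define B where "B = of_nat k * b"
  obtain e where e: "0 < e"
      "\<And>a. a \<in> atoms P \<Longrightarrow> rat_den a \<le> int k \<or> of_int (rat_num a) \<le> B \<Longrightarrow> e \<le> a"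
    using low[of B] by blast
  obtain n where n: "of_nat k + B / e \<le> of_nat n"
    using real_arch_simple by blast
  have "l \<le> n" if l: "l \<in> union_lengths P k" for l
  proof -
    obtain F G where F: "set_mset F \<subseteq> atoms P" "size F = k"
      and G: "set_mset G \<subseteq> atoms P" "size G = l"
      and eq: "sum_mset F = sum_mset G"
      using l by (auto simp: union_lengths_def length_set_def factorizations_def)
    let ?F' = "filter_mset (\<lambda>a. rat_den a \<le> int k) F"
    have "sum_mset ?F' \<le> of_nat (size ?F') * b"
      using b(2) F(1) by (intro sum_mset_le_size_times) auto
    also have "\<dots> \<le> of_nat k * b"
      using F(2) size_filter_mset_lesseq[of _ F] b(1)
      by (intro mult_right_mono) (simp_all only: of_nat_le_iff)
    finally have "sum_mset ?F' \<le> B"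
      by (simp add: B_def)
    then have "of_nat (size G) \<le> of_nat k + B / e"
      using factorization_length_bound[OF prime_den inj pos F(1) G(1) eq _ _ e] F(2) by simp
    then have "(of_nat l :: rat) \<le> of_nat n"
      using n G(2) by linarith
    then show ?thesis
      by (simp only: of_nat_le_iff)
  qed
  then have "local_elasticity P k \<le> enat n"
    unfolding local_elasticity_def by (intro Sup_least) auto
  then show ?thesis
    by (rule order_le_less_trans) simp
qed

section \<open>Atoms of a primary monoid\<close>

lemma add_submonoid_hull: "add_submonoid (monoid_span S)"
  by (rule hull_in) (auto simp: add_submonoid_def)

text \<open>Zero, the generators, and the sums of two nonzero elements together form a submonoid that
  contains the generators, so they exhaust the span; an atom can only be a generator.\<close>

lemma atoms_span_subset: "atoms (monoid_span S) \<subseteq> S"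
proof -
  define M where "M = {x \<in> monoid_span S. x = 0 \<or> x \<in> S \<or>
    (\<exists>y\<in>monoid_span S - {0}. \<exists>z\<in>monoid_span S - {0}. x = y + z)}"
  have "add_submonoid M"
    unfolding add_submonoid_def
  proof (intro conjI ballI)
    show "0 \<in> M"
      using add_submonoid_hull[of S] by (simp add: M_def add_submonoid_def)
    fix x y assume xy: "x \<in> M" "y \<in> M"
    then have "x + y \<in> monoid_span S"
      using add_submonoid_hull[of S] by (simp add: M_def add_submonoid_def)
    then show "x + y \<in> M"
      using xy by (cases "x = 0"; cases "y = 0") (auto simp: M_def)
  qed
  moreover have "S \<subseteq> M"
    by (auto simp: M_def intro: hull_inc)
  ultimately have "monoid_span S \<subseteq> M"
    by (intro hull_minimal)
  then show ?thesis
    unfolding atoms_def M_def by blast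
qed

theorem theorem4p1:
  fixes P :: "rat set"
  assumes "primary_pm P"
  shows "(\<not> (0::real) islimpt (real_of_rat ` P) \<longrightarrow>
           (\<forall>k::nat. k \<ge> 1 \<longrightarrow> local_elasticity P k < \<infinity>))
       \<and> (bounded_pm P \<and> (\<nexists>a. stable_atom P a) \<longrightarrow>
           (\<forall>k::nat. k \<ge> 1 \<longrightarrow> local_elasticity P k < \<infinity>))"
proof -
  obtain S where S: "\<And>q. q \<in> S \<Longrightarrow> 0 < q \<and> prime (rat_den q)" "inj_on rat_den S"
    "P = monoid_span S"
    using assms unfolding primary_pm_def by blast
  have sub: "atoms P \<subseteq> S"
    using atoms_span_subset S(3) by simp
  have prime_den: "prime (rat_den a)" and pos: "0 < a" if "a \<in> atoms P" for a
    using that sub S(1) by auto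
  have inj: "inj_on rat_den (atoms P)"
    using S(2) sub by (rule inj_on_subset)
  have "local_elasticity P k < \<infinity>" if nolim: "\<not> (0::real) islimpt (real_of_rat ` P)" for k
  proof (rule local_elasticity_finite[OF prime_den inj pos])
    fix B :: rat
    obtain r :: real where "r > 0" and "\<forall>y\<in>real_of_rat ` P. \<not> (y \<noteq> 0 \<and> dist y 0 < r)"
      using nolim unfolding islimpt_approachable by blast
    then have r: "r > 0" "\<And>x. x \<in> P \<Longrightarrow> x \<noteq> 0 \<Longrightarrow> r \<le> \<bar>real_of_rat x\<bar>"
      by (auto simp: not_less)
    obtain e where e: "0 < real_of_rat e" "real_of_rat e < r"
      using of_rat_dense[OF r(1)] by blast
    have "e \<le> a" if "a \<in> atoms P" for a
    proof -
      have "r \<le> real_of_rat a"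
        using r(2)[of a] that pos[OF that] by (simp add: atoms_def)
      then have "real_of_rat e < real_of_rat a"
        using e(2) by linarith
      then show ?thesis
        by (simp add: of_rat_less)
    qed
    then show "\<exists>e>0. \<forall>a\<in>atoms P. rat_den a \<le> int k \<or> of_int (rat_num a) \<le> B \<longrightarrow> e \<le> a"
      using e(1) by auto
  qed
  moreover have "local_elasticity P k < \<infinity>" if nostable: "\<nexists>a. stable_atom P a" for k
  proof (rule local_elasticity_finite[OF prime_den inj pos])
    fix B :: rat
    let ?X = "{a \<in> atoms P. rat_den a \<le> int k} \<union> {a \<in> atoms P. of_int (rat_num a) \<le> B}"
    have fibre: "finite {a \<in> atoms P. rat_num a = n}" for n
    proof (cases "\<exists>c\<in>atoms P. rat_num c = n")
      case True
      then show ?thesis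
        using nostable unfolding stable_atom_def by auto
    next
      case False
      then have "{a \<in> atoms P. rat_num a = n} = {}"
        by auto
      then show ?thesis
        by (simp only: finite.emptyI)
    qed
    have "{a \<in> atoms P. of_int (rat_num a) \<le> B}
        \<subseteq> (\<Union>n\<in>{0..\<lfloor>B\<rfloor>}. {a \<in> atoms P. rat_num a = n})"
      using rat_num_pos[THEN less_imp_le, OF pos] by (auto simp: le_floor_iff)
    then have "finite {a \<in> atoms P. of_int (rat_num a) \<le> B}"
      by (rule finite_subset) (simp add: fibre)
    then have fin: "finite ?X"
      using finite_bounded_den[OF inj] by simp
    \<comment> \<open>The element \<open>1\<close> only serves to make the set nonempty.\<close>
    define e where "e = Min (insert 1 ?X)"
    have "0 < e"
      unfolding e_def using fin pos by (subst Min_gr_iff) auto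
    moreover have "e \<le> a" if "a \<in> ?X" for a
      unfolding e_def using fin that by (intro Min_le) auto
    ultimately show "\<exists>e>0. \<forall>a\<in>atoms P. rat_den a \<le> int k \<or> of_int (rat_num a) \<le> B \<longrightarrow> e \<le> a"
      by blast
  qed
  ultimately show ?thesis
    by blast
qed

end
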